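(* Every associative magma-action is representable.
   Context: **Magma-actions.** A magma-action is a six-tuple $(X,B,\theta,\varphi,h,t)$ in which $X$ and $B$ are sets and $\varphi\colon X\times B\times X\times B\to X$, $h\colon X\to B$, $t\colon B\to X$, $\theta\colon B\times B\to B$ are maps such that for all $x,x'\in X$ $$h(\varphi(x,h(x),x',h(x')))=\theta(h(x),h(x')),$$ and such that, with $$R=\{(x,y)\in X\times B\mid \varphi(x,h(x),t(y),y)=x,\ \theta(h(x),y)=y\},$$ the following hold for all $x,x'\in X$ and $b,b'\in B$: (i) $(x,h(x))\in R$; (ii) $(t(b),b)\in R$; (iii) if $(x,b)\in R$ and $(x',b')\in R$ then $(\varphi(x,b,x',b'),\theta(b,b'))\in R$. The set $R$ carries the binary operation $$(x,b)+(x',b')=(\varphi(x,b,x',b'),\theta(b,b')).$$ **Notation.** For $x,x'\in X$ and $b,b'\in B$ put $$x+x'=\varphi(x,h(x),x',h(x')),\qquad x^b=\varphi(x,h(x),t(b),b),$$ $$b\cdot x=\varphi(t(b),b,x,h(x)),\qquad b\times b'=\varphi(t(b),b,t(b'),b').$$ **Associative.** The magma-action is associative if $(R,+)$ is a semigroup, i.e. the operation $+$ on $R$ is associative. **Representable.** The magma-action is representable if $$\varphi(x,b,x',b')=\bigl((x+b\cdot x')+\theta(b,h(x'))\times b'\bigr)^{\theta(b,b')}$$ for all $(x,b)\in R$ and $(x',b')\in R$, where $\cdot$ and $\times$ bind more tightly than $+$, i.e. the right-hand side is $\bigl((x+(b\cdot x'))+(\theta(b,h(x'))\times b')\bigr)^{\theta(b,b')}$.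 *)

theory Defs
  imports Main
begin

definition semigroup_on :: "'s set \<Rightarrow> ('s \<Rightarrow> 's \<Rightarrow> 's) \<Rightarrow> bool" where
  "semigroup_on S f \<longleftrightarrow>
     (\<forall>p\<in>S. \<forall>q\<in>S. f p q \<in> S) \<and>
     (\<forall>p\<in>S. \<forall>q\<in>S. \<forall>r\<in>S. f (f p q) r = f p (f q r))"

text \<open>
  The six-tuple is kept apart from the axioms so that the set \<open>R\<close>, which occurs in the
  axioms, can be named in them. Values of the maps outside the carriers \<open>X\<close> and \<open>B\<close>
  are irrelevant. The derived operations are written in bold, and \<open>x\<^sup>b\<close> is
  \<open>act_pow x b\<close>.
\<close>

locale magma_action_data =
  fixes X :: "'a set"
    and B :: "'b set"
    and \<theta> :: "'b \<Rightarrow> 'b \<Rightarrow> 'b"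
    and \<phi> :: "'a \<Rightarrow> 'b \<Rightarrow> 'a \<Rightarrow> 'b \<Rightarrow> 'a"
    and h :: "'a \<Rightarrow> 'b"
    and t :: "'b \<Rightarrow> 'a"
begin

definition R :: "('a \<times> 'b) set" where
  "R = {(x, y). x \<in> X \<and> y \<in> B \<and> \<phi> x (h x) (t y) y = x \<and> \<theta> (h x) y = y}"

definition R_add :: "'a \<times> 'b \<Rightarrow> 'a \<times> 'b \<Rightarrow> 'a \<times> 'b" where
  "R_add = (\<lambda>(x, b) (x', b'). (\<phi> x b x' b', \<theta> b b'))"

definition add :: "'a \<Rightarrow> 'a \<Rightarrow> 'a"  (infixl "\<^bold>+" 65) where
  "x \<^bold>+ x' = \<phi> x (h x) x' (h x')"

definition act_pow :: "'a \<Rightarrow> 'b \<Rightarrow> 'a" where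
  "act_pow x b = \<phi> x (h x) (t b) b"

definition dot :: "'b \<Rightarrow> 'a \<Rightarrow> 'a"  (infixr "\<^bold>\<cdot>" 70) where
  "b \<^bold>\<cdot> x = \<phi> (t b) b x (h x)"

definition cross :: "'b \<Rightarrow> 'b \<Rightarrow> 'a"  (infix "\<^bold>\<times>" 70) where
  "b \<^bold>\<times> b' = \<phi> (t b) b (t b') b'"

definition associative :: bool where
  "associative \<longleftrightarrow> semigroup_on R R_add"

definition representable :: bool where
  "representable \<longleftrightarrow>
     (\<forall>x b x' b'. (x, b) \<in> R \<longrightarrow> (x', b') \<in> R \<longrightarrow>
        \<phi> x b x' b' = act_pow ((x \<^bold>+ b \<^bold>\<cdot> x') \<^bold>+ \<theta> b (h x') \<^bold>\<times> b') (\<theta> b b'))"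

end

locale magma_action = magma_action_data X B \<theta> \<phi> h t
  for X :: "'a set"
    and B :: "'b set"
    and \<theta> :: "'b \<Rightarrow> 'b \<Rightarrow> 'b"
    and \<phi> :: "'a \<Rightarrow> 'b \<Rightarrow> 'a \<Rightarrow> 'b \<Rightarrow> 'a"
    and h :: "'a \<Rightarrow> 'b"
    and t :: "'b \<Rightarrow> 'a" +
  assumes theta_closed: "\<lbrakk>b \<in> B; b' \<in> B\<rbrakk> \<Longrightarrow> \<theta> b b' \<in> B"
    and phi_closed: "\<lbrakk>x \<in> X; b \<in> B; x' \<in> X; b' \<in> B\<rbrakk> \<Longrightarrow> \<phi> x b x' b' \<in> X"
    and h_closed: "x \<in> X \<Longrightarrow> h x \<in> B"
    and t_closed: "b \<in> B \<Longrightarrow> t b \<in> X"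
    and h_phi: "\<lbrakk>x \<in> X; x' \<in> X\<rbrakk> \<Longrightarrow> h (\<phi> x (h x) x' (h x')) = \<theta> (h x) (h x')"
    and h_in_R: "x \<in> X \<Longrightarrow> (x, h x) \<in> R"
    and t_in_R: "b \<in> B \<Longrightarrow> (t b, b) \<in> R"
    and R_closed: "\<lbrakk>(x, b) \<in> R; (x', b') \<in> R\<rbrakk> \<Longrightarrow> (\<phi> x b x' b', \<theta> b b') \<in> R"

end

theory Submission
  imports Defs
begin

text \<open>
  By the definition of \<open>R\<close>, every \<open>(x, b) \<in> R\<close> splits as \<open>(x, h x) + (t b, b)\<close>. Hence
  \<open>(x, b) + (x', b') = (x, h x) + (t b, b) + (x', h x') + (t b', b')\<close>. Splitting the sum of
  the two middle terms again, then that of the last two terms, collects all contributions of the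
  form \<open>(y, h y)\<close> on the left, where they add up to one such element, and leaves a single
  \<open>(t c, c)\<close> on the right.
\<close>

context magma_action
begin

lemma R_carriers:
  assumes "(x, b) \<in> R"
  shows "x \<in> X" and "b \<in> B"
  using assms by (auto simp: R_def)

lemma R_split:
  assumes "(x, b) \<in> R"
  shows "R_add (x, h x) (t b, b) = (x, b)"
  using assms by (simp add: R_def R_add_def)

lemma R_add_closed:
  assumes "p \<in> R" "q \<in> R"
  shows "R_add p q \<in> R"
  using assms R_closed by (cases p; cases q) (simp add: R_add_def)

text \<open>The axiom \<open>h_phi\<close> is exactly the agreement of the second components. It
  lets the pairs on the left of the big sum merge into one of the same form.\<close>

lemma R_add_graph:
  assumes "x \<in> X" "y \<in> X"
  shows "R_add (x, h x) (y, h y) = (x \<^bold>+ y, h (x \<^bold>+ y))"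
  using h_phi[OF assms] by (simp add: R_add_def add_def)

lemma associative_imp_representable:
  assumes associative
  shows representable
  unfolding representable_def
proof (intro allI impI)
  fix x b x' b'
  assume xb: "(x, b) \<in> R" and xb': "(x', b') \<in> R"
  \<comment> \<open>The second component of the sum of \<open>(t b, b)\<close> and
    \<open>(x', h x')\<close>. It may differ from the \<open>h\<close>-value of the first component,
    so that sum has to be split again.\<close>
  define c where "c = \<theta> b (h x')"
  have assoc: "R_add (R_add p q) r = R_add p (R_add q r)"
    if "p \<in> R" "q \<in> R" "r \<in> R" for p q r
    using assms that by (simp add: associative_def semigroup_on_def)
  have X: "x \<in> X" "x' \<in> X" and B: "b \<in> B" "b' \<in> B"
    using xb xb' by (auto dest: R_carriers)
  note R = h_in_R[OF X(1)] h_in_R[OF X(2)] t_in_R[OF B(1)] t_in_R[OF B(2)]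
  have dot: "R_add (t b, b) (x', h x') = (b \<^bold>\<cdot> x', c)"
    by (simp add: R_add_def dot_def c_def)
  then have dot_R: "(b \<^bold>\<cdot> x', c) \<in> R"
    using R_add_closed R by metis
  have bx: "b \<^bold>\<cdot> x' \<in> X" and c: "c \<in> B"
    using R_carriers[OF dot_R] by auto
  have cross: "R_add (t c, c) (t b', b') = (c \<^bold>\<times> b', \<theta> c b')"
    by (simp add: R_add_def cross_def)
  then have cross_R: "(c \<^bold>\<times> b', \<theta> c b') \<in> R"
    using R_add_closed R t_in_R[OF c] by metis
  have cb: "c \<^bold>\<times> b' \<in> X" and d: "\<theta> c b' \<in> B"
    using R_carriers[OF cross_R] by auto
  let ?y = "x \<^bold>+ b \<^bold>\<cdot> x'"
  have y: "?y \<in> X"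
    using phi_closed X bx h_closed by (simp add: add_def)
  \<comment> \<open>Regrouping rejoins \<open>(x', h x')\<close> and \<open>(t b', b')\<close> to
    \<open>(x', b')\<close>; the second components then give the exponent required by
    representability.\<close>
  have "R_add (b \<^bold>\<cdot> x', c) (t b', b') = R_add (t b, b) (x', b')"
    using assoc[OF R(3) R(2) R(4)] by (simp add: dot R_split[OF xb'])
  then have theta: "\<theta> c b' = \<theta> b b'"
    by (simp add: R_add_def)
  have "R_add (x, b) (x', b')
      = R_add (R_add (x, h x) (t b, b)) (R_add (x', h x') (t b', b'))"
    by (simp add: R_split xb xb')
  also have "\<dots> = R_add (x, h x) (R_add (R_add (t b, b) (x', h x')) (t b', b'))"
    by (simp add: assoc R R_add_closed)
  also have "\<dots> = R_add (x, h x) (R_add (R_add (b \<^bold>\<cdot> x', h (b \<^bold>\<cdot> x')) (t c, c)) (t b', b'))"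
    by (simp add: dot R_split[OF dot_R])
  also have "\<dots> = R_add (R_add (x, h x) (b \<^bold>\<cdot> x', h (b \<^bold>\<cdot> x'))) (R_add (t c, c) (t b', b'))"
    by (simp add: assoc R R_add_closed h_in_R t_in_R bx c)
  also have "\<dots> = R_add (?y, h ?y) (R_add (c \<^bold>\<times> b', h (c \<^bold>\<times> b')) (t (\<theta> c b'), \<theta> c b'))"
    by (simp add: R_add_graph X bx cross R_split[OF cross_R])
  also have "\<dots> = R_add (R_add (?y, h ?y) (c \<^bold>\<times> b', h (c \<^bold>\<times> b'))) (t (\<theta> c b'), \<theta> c b')"
    by (simp add: assoc h_in_R t_in_R y cb d)
  also have "\<dots> = R_add (?y \<^bold>+ c \<^bold>\<times> b', h (?y \<^bold>+ c \<^bold>\<times> b')) (t (\<theta> b b'), \<theta> b b')"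
    by (simp add: R_add_graph y cb theta)
  \<comment> \<open>Compare first components: that of \<open>(z, h z)\<close> plus
    \<open>(t d, d)\<close> is \<open>act_pow z d\<close> by definition.\<close>
  finally show "\<phi> x b x' b' = act_pow (?y \<^bold>+ \<theta> b (h x') \<^bold>\<times> b') (\<theta> b b')"
    by (simp add: R_add_def act_pow_def c_def)
qed

end

theorem proposition1:
  fixes X :: "'a set"
    and B :: "'b set"
    and \<theta> :: "'b \<Rightarrow> 'b \<Rightarrow> 'b"
    and \<phi> :: "'a \<Rightarrow> 'b \<Rightarrow> 'a \<Rightarrow> 'b \<Rightarrow> 'a"
    and h :: "'a \<Rightarrow> 'b"
    and t :: "'b \<Rightarrow> 'a"
  assumes "magma_action X B \<theta> \<phi> h t"
    and "magma_action_data.associative X B \<theta> \<phi> h t"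
  shows "magma_action_data.representable X B \<theta> \<phi> h t"
  using magma_action.associative_imp_representable assms .

end
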